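(* Let $S_1$ and $S_2$ be finite sets and let $\varphi_1\colon 2^{S_1}\to\mathbb{R}_+$ and $\varphi_2\colon 2^{S_2}\to\mathbb{R}_+$ be submodular functions with $\varphi_1(\emptyset)=0$ and $\varphi_2(\emptyset)=0$. Let $\mu_1\colon S_1\to\mathbb{R}_+$ and $\mu_2\colon S_2\to\mathbb{R}_+$ satisfy $\mu_1(S_1)=\varphi_1(S_1)$ and $\mu_2(S_2)=\varphi_2(S_2)$, where $\mu_i(X)=\sum_{x\in X}\mu_i(x)$. Define $b\colon 2^{S_1\times S_2}\to\mathbb{R}$ by \[ b(Z)=\sum_{e_1\in S_1}\mu_1(e_1)\,\varphi_2\bigl(\{y\in S_2 : (e_1,y)\in Z\}\bigr)+\sum_{e_2\in S_2}\mu_2(e_2)\,\varphi_1\bigl(\{x\in S_1 : (x,e_2)\in Z\}\bigr)-\sum_{(e_1,e_2)\in Z}\mu_1(e_1)\mu_2(e_2). \] Then $b$ is a submodular coupling of $\varphi_1$ and $\varphi_2$.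
   Context: A set function $\varphi$ on $2^S$ is submodular if $\varphi(X)+\varphi(Y)\ge\varphi(X\cap Y)+\varphi(X\cup Y)$ for all $X,Y\subseteq S$. A function $\varphi\colon 2^{S_1\times S_2}\to\mathbb{R}$ is a coupling of $\varphi_1\colon 2^{S_1}\to\mathbb{R}$ and $\varphi_2\colon 2^{S_2}\to\mathbb{R}$ if $\varphi(X_1\times S_2)=\varphi_1(X_1)\cdot\varphi_2(S_2)$ for every $X_1\subseteq S_1$ and $\varphi(S_1\times X_2)=\varphi_1(S_1)\cdot\varphi_2(X_2)$ for every $X_2\subseteq S_2$. *)

theory Defs
  imports Complex_Main
begin

(* Set functions on 2^S are total functions on 'a set; only their values on subsets of S matter. *)

definition submodular_on :: "'a set \<Rightarrow> ('a set \<Rightarrow> real) \<Rightarrow> bool" where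
  "submodular_on S \<phi> \<longleftrightarrow>
     (\<forall>X Y. X \<subseteq> S \<longrightarrow> Y \<subseteq> S \<longrightarrow> \<phi> X + \<phi> Y \<ge> \<phi> (X \<inter> Y) + \<phi> (X \<union> Y))"

definition coupling ::
  "'a set \<Rightarrow> 'b set \<Rightarrow> ('a set \<Rightarrow> real) \<Rightarrow> ('b set \<Rightarrow> real) \<Rightarrow> (('a \<times> 'b) set \<Rightarrow> real) \<Rightarrow> bool"
where
  "coupling S1 S2 \<phi>1 \<phi>2 \<phi> \<longleftrightarrow>
     (\<forall>X1. X1 \<subseteq> S1 \<longrightarrow> \<phi> (X1 \<times> S2) = \<phi>1 X1 * \<phi>2 S2) \<and>
     (\<forall>X2. X2 \<subseteq> S2 \<longrightarrow> \<phi> (S1 \<times> X2) = \<phi>1 S1 * \<phi>2 X2)"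

end

theory Submission
  imports Defs
begin

text \<open>
  Taking fibres commutes with unions and intersections, so the first two sums defining \<open>b\<close> are
  nonnegative combinations of submodular functions, while the third is modular. On a rectangle
  \<open>X1 \<times> X2\<close> the formula collapses to
  \<open>\<mu>1 X1 * \<phi>2 X2 + \<mu>2 X2 * \<phi>1 X1 - \<mu>1 X1 * \<mu>2 X2\<close>, and if one side is full then
  \<open>\<mu>i Si = \<phi>i Si\<close> makes two of the terms cancel.
\<close>

text \<open>The map \<open>g\<close> covers both kinds of fibre: \<open>g i x = (i, x)\<close> gives
  the first sum of \<open>b\<close> and \<open>g i x = (x, i)\<close> the second. The ground set
  \<open>T\<close> can be arbitrary because each fibre is cut down to \<open>S\<close> by its
  definition, so the submodularity of \<open>\<phi>\<close> on \<open>S\<close> always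
  applies.\<close>

lemma submodular_on_sum_fibres:
  fixes \<phi> :: "'a set \<Rightarrow> real" and w :: "'i \<Rightarrow> real" and g :: "'i \<Rightarrow> 'a \<Rightarrow> 'c"
  assumes sub: "submodular_on S \<phi>" and w: "\<And>i. i \<in> I \<Longrightarrow> w i \<ge> 0"
  shows "submodular_on T (\<lambda>Z. \<Sum>i\<in>I. w i * \<phi> {x \<in> S. g i x \<in> Z})"
  unfolding submodular_on_def
proof (intro allI impI)
  fix X Y
  let ?F = "\<lambda>i Z. {x \<in> S. g i x \<in> Z}"
  have "w i * \<phi> (?F i (X \<inter> Y)) + w i * \<phi> (?F i (X \<union> Y)) \<le> w i * \<phi> (?F i X) + w i * \<phi> (?F i Y)"
    if "i \<in> I" for i
  proof -
    have fibre: "?F i (X \<inter> Y) = ?F i X \<inter> ?F i Y" "?F i (X \<union> Y) = ?F i X \<union> ?F i Y"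
      by auto
    have "\<phi> (?F i X \<inter> ?F i Y) + \<phi> (?F i X \<union> ?F i Y) \<le> \<phi> (?F i X) + \<phi> (?F i Y)"
      by (rule sub[unfolded submodular_on_def, rule_format]) auto
    from mult_left_mono[OF this w[OF that]] show ?thesis
      unfolding fibre distrib_left .
  qed
  then have "(\<Sum>i\<in>I. w i * \<phi> (?F i (X \<inter> Y)) + w i * \<phi> (?F i (X \<union> Y)))
      \<le> (\<Sum>i\<in>I. w i * \<phi> (?F i X) + w i * \<phi> (?F i Y))"
    by (rule sum_mono)
  then show "(\<Sum>i\<in>I. w i * \<phi> (?F i (X \<inter> Y))) + (\<Sum>i\<in>I. w i * \<phi> (?F i (X \<union> Y)))
      \<le> (\<Sum>i\<in>I. w i * \<phi> (?F i X)) + (\<Sum>i\<in>I. w i * \<phi> (?F i Y))"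
    by (simp only: sum.distrib)
qed

text \<open>Indices outside \<open>X\<close> have an empty fibre and contribute nothing because
  \<open>\<phi> {} = 0\<close>; the remaining terms share the factor \<open>\<phi> Y\<close>.
  Leaving \<open>F\<close> abstract lets rows and columns of a rectangle be treated alike.\<close>

lemma sum_fibres_rectangle:
  fixes \<phi> :: "'b set \<Rightarrow> real" and w :: "'a \<Rightarrow> real"
  assumes "finite S" "X \<subseteq> S" "\<phi> {} = 0" and "\<And>e. F e = (if e \<in> X then Y else {})"
  shows "(\<Sum>e\<in>S. w e * \<phi> (F e)) = sum w X * \<phi> Y"
proof -
  have "(\<Sum>e\<in>S. w e * \<phi> (F e)) = (\<Sum>e\<in>X. w e * \<phi> Y)"
    using assms by (intro sum.mono_neutral_cong_right) auto
  then show ?thesis by (simp add: sum_distrib_right)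
qed

theorem theorem3p1:
  fixes S1 :: "'a set" and S2 :: "'b set"
    and \<phi>1 :: "'a set \<Rightarrow> real" and \<phi>2 :: "'b set \<Rightarrow> real"
    and \<mu>1 :: "'a \<Rightarrow> real" and \<mu>2 :: "'b \<Rightarrow> real"
    and b :: "('a \<times> 'b) set \<Rightarrow> real"
  assumes "finite S1" and "finite S2"
    and "\<And>X. X \<subseteq> S1 \<Longrightarrow> \<phi>1 X \<ge> 0" and "\<And>Y. Y \<subseteq> S2 \<Longrightarrow> \<phi>2 Y \<ge> 0"
    and "submodular_on S1 \<phi>1" and "submodular_on S2 \<phi>2"
    and "\<phi>1 {} = 0" and "\<phi>2 {} = 0"
    and "\<And>x. x \<in> S1 \<Longrightarrow> \<mu>1 x \<ge> 0" and "\<And>y. y \<in> S2 \<Longrightarrow> \<mu>2 y \<ge> 0"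
    and "(\<Sum>x\<in>S1. \<mu>1 x) = \<phi>1 S1" and "(\<Sum>y\<in>S2. \<mu>2 y) = \<phi>2 S2"
    and "\<And>Z. Z \<subseteq> S1 \<times> S2 \<Longrightarrow>
           b Z = (\<Sum>e1\<in>S1. \<mu>1 e1 * \<phi>2 {y \<in> S2. (e1, y) \<in> Z})
               + (\<Sum>e2\<in>S2. \<mu>2 e2 * \<phi>1 {x \<in> S1. (x, e2) \<in> Z})
               - (\<Sum>(e1, e2)\<in>Z. \<mu>1 e1 * \<mu>2 e2)"
  shows "submodular_on (S1 \<times> S2) b \<and> coupling S1 S2 \<phi>1 \<phi>2 b"
proof
  define A where "A Z = (\<Sum>e1\<in>S1. \<mu>1 e1 * \<phi>2 {y \<in> S2. (e1, y) \<in> Z})" for Z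
  define B where "B Z = (\<Sum>e2\<in>S2. \<mu>2 e2 * \<phi>1 {x \<in> S1. (x, e2) \<in> Z})" for Z
  define C where "C Z = (\<Sum>(e1, e2)\<in>Z. \<mu>1 e1 * \<mu>2 e2)" for Z
  have b: "b Z = A Z + B Z - C Z" if "Z \<subseteq> S1 \<times> S2" for Z
    unfolding A_def B_def C_def by (rule assms(13)[OF that])
  show "submodular_on (S1 \<times> S2) b"
    unfolding submodular_on_def
  proof (intro allI impI)
    fix X Y assume X: "X \<subseteq> S1 \<times> S2" and Y: "Y \<subseteq> S1 \<times> S2"
    have "submodular_on (S1 \<times> S2) A" "submodular_on (S1 \<times> S2) B"
      unfolding A_def B_def by (rule submodular_on_sum_fibres; fact)+
    then have "A (X \<inter> Y) + A (X \<union> Y) \<le> A X + A Y" "B (X \<inter> Y) + B (X \<union> Y) \<le> B X + B Y"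
      using X Y unfolding submodular_on_def by auto
    moreover have "finite X" "finite Y"
      using X Y assms(1,2) by (auto intro: finite_subset)
    \<comment> \<open>Every pair is counted equally often on both sides, so subtracting
      \<open>C\<close> does not affect the inequality obtained for \<open>A\<close> and
      \<open>B\<close>.\<close>
    then have "C (X \<inter> Y) + C (X \<union> Y) = C X + C Y"
      unfolding C_def by (subst add.commute) (rule sum.union_inter)
    moreover have "b (X \<inter> Y) = A (X \<inter> Y) + B (X \<inter> Y) - C (X \<inter> Y)"
      "b (X \<union> Y) = A (X \<union> Y) + B (X \<union> Y) - C (X \<union> Y)"
      using X Y by (auto intro!: b)
    ultimately show "b (X \<inter> Y) + b (X \<union> Y) \<le> b X + b Y"
      using b[OF X] b[OF Y] by linarith
  qed
  have rectangle: "b (X1 \<times> X2) = sum \<mu>1 X1 * \<phi>2 X2 + sum \<mu>2 X2 * \<phi>1 X1 - sum \<mu>1 X1 * sum \<mu>2 X2"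
    if X: "X1 \<subseteq> S1" "X2 \<subseteq> S2" for X1 X2
  proof -
    \<comment> \<open>As \<open>X2 \<subseteq> S2\<close>, the fibre over a point of
      \<open>X1\<close> is all of \<open>X2\<close>, not merely
      \<open>X2 \<inter> S2\<close>.\<close>
    have "A (X1 \<times> X2) = sum \<mu>1 X1 * \<phi>2 X2"
      unfolding A_def using X assms(1,8) by (intro sum_fibres_rectangle) auto
    moreover have "B (X1 \<times> X2) = sum \<mu>2 X2 * \<phi>1 X1"
      unfolding B_def using X assms(2,7) by (intro sum_fibres_rectangle) auto
    moreover have "C (X1 \<times> X2) = sum \<mu>1 X1 * sum \<mu>2 X2"
      unfolding C_def by (simp add: sum_product sum.cartesian_product)
    ultimately show ?thesis
      using b[of "X1 \<times> X2"] X by auto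
  qed
  \<comment> \<open>For \<open>X2 = S2\<close> the first and third terms of \<open>rectangle\<close>
    cancel, since \<open>sum \<mu>2 S2 = \<phi>2 S2\<close>; for \<open>X1 = S1\<close> the second
    and third cancel, since \<open>sum \<mu>1 S1 = \<phi>1 S1\<close>.\<close>
  show "coupling S1 S2 \<phi>1 \<phi>2 b"
    unfolding coupling_def using assms(11,12) by (auto simp: rectangle)
qed

end
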